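(* Let $\mathcal{K}\subseteq\mathcal{L}$ be MU-categories. If $\mathcal{K}\subseteq\mathcal{L}$ is $\sigma$-consistent, then $\mathcal{B}_0=\overline{\mathrm{cl}^{\mathrm{lim}}(\mathcal{K})}$ and $\mathcal{B}_1=\sigma\mathcal{K}$.
   Context: An $\infty$-metric is a metric allowed to take the value $\infty$. An MU-category is a category with an $\infty$-metric $d$ on every hom-set such that (1) $d(g\circ f,h\circ f)\le d(g,h)$ for all maps $f$ and all compatible $g,h$, and (2) for every map $f$ and $\varepsilon>0$ there is $\delta>0$ such that for every object $W$ and all $g,h\colon W\to\mathrm{dom}(f)$, $d(g,h)<\delta$ implies $d(f\circ g,f\circ h)<\varepsilon$. We write $f\approx_\varepsilon g$ for $d(f,g)<\varepsilon$. A category is identified with its class of morphisms; $\mathcal{K}\subseteq\mathcal{L}$ is a (not necessarily full) subcategory with restricted metrics. A $\mathcal{K}$-sequence $\langle X_*,f_*\rangle$ consists of $\mathcal{K}$-maps $f_n\colon X_{n+1}\to X_n$, $n\in\omega$. An $\mathcal{L}$-limit $\langle X_\infty,f_{*,\infty}\rangle$ is a category-theoretic inverse limit in $\mathcal{L}$ with cone maps $f_{n,\infty}\colon X_\infty\to X_n$. For a family of maps $\mathcal{F}\subseteq\mathcal{L}$, $\overline{\mathcal{F}}$ denotes the local closure: $\overline{\mathcal{F}}\cap\mathcal{L}(X,Y)$ is the closure of $\mathcal{F}\cap\mathcal{L}(X,Y)$ in $\mathcal{L}(X,Y)$ for all $\mathcal{L}$-objects $X,Y$. $\mathrm{cl}^{\mathrm{lim}}(\mathcal{K})$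 consists of $\mathcal{K}$ together with all maps $f_{n,\infty}$, $n\in\omega$, where $f_{*,\infty}$ is an $\mathcal{L}$-limit cone of a $\mathcal{K}$-sequence $f_*$. The $\sigma$-closure $\sigma\mathcal{K}\subseteq\mathcal{L}$ is the smallest subcategory $\mathcal{L}'\subseteq\mathcal{L}$ such that: $\mathcal{K}\subseteq\mathcal{L}'$; $\overline{\mathcal{L}'}=\mathcal{L}'$; $\mathcal{L}'$ contains all $\mathcal{L}$-limit cones of $\mathcal{K}$-sequences; and if $f_{*,\infty}$ is an $\mathcal{L}$-limit cone of a $\mathcal{K}$-sequence with limit object $X_\infty$ and $h\colon Y\to X_\infty$ is an $\mathcal{L}$-map with $f_{n,\infty}\circ h\in\mathcal{L}'$ for every $n$, then $h\in\mathcal{L}'$. The $\sigma\mathcal{K}$-objects are exactly the $\mathcal{L}$-limit objects of $\mathcal{K}$-sequences. $\mathcal{B}_0$ is the family of all $\mathcal{L}$-maps $h\colon X\to Y$ from a $\sigma\mathcal{K}$-object $X$ to a $\mathcal{K}$-object $Y$ such that for every $\mathcal{K}$-sequence $\langle X_*,f_*\rangle$ with an $\mathcal{L}$-limit $\langle X,f_{*,\infty}\rangle$ and every $\varepsilon>0$ there is $n\in\omega$ and a $\mathcal{K}$-map $g\colon X_n\to Y$ with $h\approx_\varepsilon g\circ f_{n,\infty}$. $\mathcal{B}_1$ is the family of all $\mathcal{L}$-maps $h$ between $\sigma\mathcal{K}$-objects such that $g\circ h\in\mathcal{B}_0$ for every $g\in\mathcal{B}_0$ with $\mathrm{dom}(g)=\mathrm{cod}(h)$.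 $\mathcal{K}\subseteq\mathcal{L}$ is $\sigma$-consistent if for every pair of $\mathcal{K}$-sequences $\langle X_*,f_*\rangle$, $\langle Y_*,g_*\rangle$ with $\mathcal{L}$-limits $\langle X_\infty,f_{*,\infty}\rangle$, $\langle Y_\infty,g_{*,\infty}\rangle$ such that $X_\infty=Y_\infty$, and every $n\in\omega$ and $\varepsilon>0$, there is $m\in\omega$ and a $\mathcal{K}$-map $h\colon X_m\to Y_n$ such that $h\circ f_{m,\infty}\approx_\varepsilon g_{n,\infty}$. *)

theory Defs
  imports "HOL-Analysis.Analysis"
begin

section \<open>MU-categories\<close>

record ('o, 'a) cat =
  Obj :: "'o set"
  Arr :: "'a set"
  Dom :: "'a \<Rightarrow> 'o"
  Cod :: "'a \<Rightarrow> 'o"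
  Ide :: "'o \<Rightarrow> 'a"
  Comp :: "'a \<Rightarrow> 'a \<Rightarrow> 'a"  (infixl \<open>\<cdot>\<index>\<close> 70)

definition hom_set :: "('o, 'a, 'z) cat_scheme \<Rightarrow> 'o \<Rightarrow> 'o \<Rightarrow> 'a set" where
  "hom_set L X Y = {f \<in> Arr L. Dom L f = X \<and> Cod L f = Y}"

text \<open>Composition is written in applicative order: \<open>g \<cdot> f\<close> is \<open>g\<close> after \<open>f\<close>. The operations
  are total functions, but only their values on \<^const>\<open>Obj\<close>, on \<^const>\<open>Arr\<close> and on
  composable pairs matter.\<close>

locale category =
  fixes L :: "('o, 'a, 'z) cat_scheme" (structure)
  assumes Dom_in_Obj: "f \<in> Arr L \<Longrightarrow> Dom L f \<in> Obj L"
    and Cod_in_Obj: "f \<in> Arr L \<Longrightarrow> Cod L f \<in> Obj L"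
    and Ide_in_hom: "X \<in> Obj L \<Longrightarrow> Ide L X \<in> hom_set L X X"
    and Comp_in_hom: "\<lbrakk>f \<in> hom_set L X Y; g \<in> hom_set L Y Z\<rbrakk> \<Longrightarrow> g \<cdot> f \<in> hom_set L X Z"
    and Comp_Ide: "f \<in> hom_set L X Y \<Longrightarrow> f \<cdot> Ide L X = f"
    and Ide_Comp: "f \<in> hom_set L X Y \<Longrightarrow> Ide L Y \<cdot> f = f"
    and Comp_assoc: "\<lbrakk>f \<in> hom_set L W X; g \<in> hom_set L X Y; h \<in> hom_set L Y Z\<rbrakk>
          \<Longrightarrow> (h \<cdot> g) \<cdot> f = h \<cdot> (g \<cdot> f)"

text \<open>The distance of two arrows is meaningful only if they are parallel.\<close>

record ('o, 'a) metric_cat = "('o, 'a) cat" +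
  mdist :: "'a \<Rightarrow> 'a \<Rightarrow> ennreal"

locale mu_category = category L
  for L :: "('o, 'a, 'z) metric_cat_scheme" (structure) +
  assumes mdist_eq_0: "\<lbrakk>f \<in> hom_set L X Y; g \<in> hom_set L X Y\<rbrakk> \<Longrightarrow> mdist L f g = 0 \<longleftrightarrow> f = g"
    and mdist_commute: "\<lbrakk>f \<in> hom_set L X Y; g \<in> hom_set L X Y\<rbrakk> \<Longrightarrow> mdist L f g = mdist L g f"
    and mdist_triangle: "\<lbrakk>f \<in> hom_set L X Y; g \<in> hom_set L X Y; h \<in> hom_set L X Y\<rbrakk>
          \<Longrightarrow> mdist L f h \<le> mdist L f g + mdist L g h"
    and mdist_Comp_le: "\<lbrakk>f \<in> hom_set L X Y; g \<in> hom_set L Y Z; h \<in> hom_set L Y Z\<rbrakk>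
          \<Longrightarrow> mdist L (g \<cdot> f) (h \<cdot> f) \<le> mdist L g h"
    and Comp_uniform: "\<And>f X Y (\<epsilon>::real). \<lbrakk>f \<in> hom_set L X Y; \<epsilon> > 0\<rbrakk> \<Longrightarrow>
          \<exists>\<delta>::real. \<delta> > 0 \<and> (\<forall>W\<in>Obj L. \<forall>g\<in>hom_set L W X. \<forall>h\<in>hom_set L W X.
             mdist L g h < ennreal \<delta> \<longrightarrow> mdist L (f \<cdot> g) (f \<cdot> h) < ennreal \<epsilon>)"

definition approx :: "('o, 'a, 'z) metric_cat_scheme \<Rightarrow> real \<Rightarrow> 'a \<Rightarrow> 'a \<Rightarrow> bool" where
  "approx L \<epsilon> f g \<longleftrightarrow> mdist L f g < ennreal \<epsilon>"


section \<open>Subcategories\<close>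

text \<open>A subcategory of \<open>L\<close> is given by its class of arrows; its objects are those whose
  identity it contains.\<close>

definition subcategory :: "('o, 'a, 'z) cat_scheme \<Rightarrow> 'a set \<Rightarrow> bool" where
  "subcategory L K \<longleftrightarrow> K \<subseteq> Arr L \<and>
     (\<forall>f\<in>K. Ide L (Dom L f) \<in> K \<and> Ide L (Cod L f) \<in> K) \<and>
     (\<forall>f\<in>K. \<forall>g\<in>K. Dom L g = Cod L f \<longrightarrow> g \<cdot>\<^bsub>L\<^esub> f \<in> K)"

definition objs :: "('o, 'a, 'z) cat_scheme \<Rightarrow> 'a set \<Rightarrow> 'o set" where
  "objs L K = {X \<in> Obj L. Ide L X \<in> K}"

text \<open>With the restricted metrics, a subcategory of an MU-category is automatically an
  MU-category.\<close>

lemma (in mu_category) subcategory_imp_mu_category: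
  assumes "subcategory L K"
  shows "mu_category (L\<lparr>Obj := objs L K, Arr := K\<rparr>)"
proof -
  have K: "K \<subseteq> Arr L" and KD: "\<And>f. f \<in> K \<Longrightarrow> Ide L (Dom L f) \<in> K"
    and KC: "\<And>f. f \<in> K \<Longrightarrow> Ide L (Cod L f) \<in> K"
    and KM: "\<And>f g. \<lbrakk>f \<in> K; g \<in> K; Dom L g = Cod L f\<rbrakk> \<Longrightarrow> g \<cdot> f \<in> K"
    using assms unfolding subcategory_def by auto
  have sub: "hom_set (L\<lparr>Obj := objs L K, Arr := K\<rparr>) X Y = hom_set L X Y \<inter> K" for X Y
    using K by (auto simp: hom_set_def)
  show ?thesis
  proof (unfold_locales, unfold sub, goal_cases)
    case (1 f) then show ?case using K KD Dom_in_Obj by (auto simp: objs_def)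
  next
    case (2 f) then show ?case using K KC Cod_in_Obj by (auto simp: objs_def)
  next
    case (3 X) then show ?case using Ide_in_hom by (auto simp: objs_def)
  next
    case (4 f X Y g Z) then show ?case
      using Comp_in_hom[of f X Y g Z] KM[of f g] by (auto simp: hom_set_def)
  next
    case (5 f X Y) then show ?case using Comp_Ide by auto
  next
    case (6 f X Y) then show ?case using Ide_Comp by auto
  next
    case (7 f W X g Y h Z) then show ?case using Comp_assoc by auto
  next
    case (8 f X Y g) then show ?case using mdist_eq_0 by auto
  next
    case (9 f X Y g) then show ?case using mdist_commute by auto
  next
    case (10 f X Y g h) then show ?case using mdist_triangle by auto
  next
    case (11 f X Y g Z h) then show ?case using mdist_Comp_le by auto
  next
    case (12 f X Y \<epsilon>)
    then obtain \<delta> :: real where "\<delta> > 0"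
      and "\<forall>W\<in>Obj L. \<forall>g\<in>hom_set L W X. \<forall>h\<in>hom_set L W X.
             mdist L g h < ennreal \<delta> \<longrightarrow> mdist L (f \<cdot> g) (f \<cdot> h) < ennreal \<epsilon>"
      using Comp_uniform by blast
    then show ?case by (intro exI[of _ \<delta>]) (auto simp: objs_def)
  qed
qed


section \<open>Local closure\<close>

definition hom_open :: "('o, 'a, 'z) metric_cat_scheme \<Rightarrow> 'o \<Rightarrow> 'o \<Rightarrow> 'a set \<Rightarrow> bool" where
  "hom_open L X Y U \<longleftrightarrow> U \<subseteq> hom_set L X Y \<and>
     (\<forall>f\<in>U. \<exists>\<epsilon>::real. \<epsilon> > 0 \<and> (\<forall>g\<in>hom_set L X Y. approx L \<epsilon> f g \<longrightarrow> g \<in> U))"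

definition hom_topology :: "('o, 'a, 'z) metric_cat_scheme \<Rightarrow> 'o \<Rightarrow> 'o \<Rightarrow> 'a topology" where
  "hom_topology L X Y = topology (hom_open L X Y)"

lemma istopology_hom_open: "istopology (hom_open L X Y)"
  unfolding istopology_def
proof (intro conjI allI impI)
  fix S T assume S: "hom_open L X Y S" and T: "hom_open L X Y T"
  show "hom_open L X Y (S \<inter> T)"
    unfolding hom_open_def
  proof (intro conjI ballI)
    show "S \<inter> T \<subseteq> hom_set L X Y" using S by (auto simp: hom_open_def)
  next
    fix f assume f: "f \<in> S \<inter> T"
    obtain a :: real where a: "a > 0" "\<forall>g\<in>hom_set L X Y. approx L a f g \<longrightarrow> g \<in> S"
      using S f unfolding hom_open_def by blast
    obtain b :: real where b: "b > 0" "\<forall>g\<in>hom_set L X Y. approx L b f g \<longrightarrow> g \<in> T"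
      using T f unfolding hom_open_def by blast
    have "approx L a f g" "approx L b f g" if "approx L (min a b) f g" for g
      using that unfolding approx_def
      by (meson ennreal_leI less_le_trans min.cobounded1 min.cobounded2)+
    then show "\<exists>\<epsilon>::real. \<epsilon> > 0 \<and> (\<forall>g\<in>hom_set L X Y. approx L \<epsilon> f g \<longrightarrow> g \<in> S \<inter> T)"
      using a b by (intro exI[of _ "min a b"]) auto
  qed
next
  fix \<U> assume "\<forall>U\<in>\<U>. hom_open L X Y U"
  then show "hom_open L X Y (\<Union>\<U>)"
    unfolding hom_open_def by (meson Sup_le_iff UnionE UnionI)
qed

definition local_closure :: "('o, 'a, 'z) metric_cat_scheme \<Rightarrow> 'a set \<Rightarrow> 'a set" where
  "local_closure L F =
     (\<Union>X\<in>Obj L. \<Union>Y\<in>Obj L. hom_topology L X Y closure_of (F \<inter> hom_set L X Y))"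

lemma openin_hom_topology: "openin (hom_topology L X Y) = hom_open L X Y"
  unfolding hom_topology_def by (rule topology_inverse'[OF istopology_hom_open])

lemma topspace_hom_topology: "topspace (hom_topology L X Y) = hom_set L X Y"
proof -
  have "hom_open L X Y (hom_set L X Y)"
    unfolding hom_open_def using zero_less_one by blast
  then show ?thesis
    unfolding topspace_def openin_hom_topology
    by (intro equalityI Union_least Union_upper) (simp_all add: hom_open_def)
qed

lemma local_closure_Int_hom_set:
  assumes "X \<in> Obj L" "Y \<in> Obj L"
  shows "local_closure L F \<inter> hom_set L X Y
           = hom_topology L X Y closure_of (F \<inter> hom_set L X Y)"
proof -
  have *: "hom_topology L X' Y' closure_of (F \<inter> hom_set L X' Y') \<subseteq> hom_set L X' Y'" for X' Y'
    by (metis closure_of_subset_topspace topspace_hom_topology)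
  have "X' = X \<and> Y' = Y" if "f \<in> hom_set L X Y"
    "f \<in> hom_topology L X' Y' closure_of (F \<inter> hom_set L X' Y')" for f X' Y'
    using that *[of X' Y'] by (auto simp: hom_set_def)
  then show ?thesis
    using assms *[of X Y] unfolding local_closure_def by blast
qed


section \<open>Sequences, limits, and the closure of a subcategory under limits\<close>

definition is_sequence ::
  "('o, 'a, 'z) cat_scheme \<Rightarrow> 'a set \<Rightarrow> (nat \<Rightarrow> 'o) \<Rightarrow> (nat \<Rightarrow> 'a) \<Rightarrow> bool" where
  "is_sequence L K X f \<longleftrightarrow> (\<forall>n. f n \<in> K \<inter> hom_set L (X (Suc n)) (X n))"

definition is_cone ::
  "('o, 'a, 'z) cat_scheme \<Rightarrow> (nat \<Rightarrow> 'o) \<Rightarrow> (nat \<Rightarrow> 'a) \<Rightarrow> 'o \<Rightarrow> (nat \<Rightarrow> 'a) \<Rightarrow> bool" where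
  "is_cone L X f W c \<longleftrightarrow> W \<in> Obj L \<and>
     (\<forall>n. c n \<in> hom_set L W (X n) \<and> f n \<cdot>\<^bsub>L\<^esub> c (Suc n) = c n)"

definition is_limit ::
  "('o, 'a, 'z) cat_scheme \<Rightarrow> (nat \<Rightarrow> 'o) \<Rightarrow> (nat \<Rightarrow> 'a) \<Rightarrow> 'o \<Rightarrow> (nat \<Rightarrow> 'a) \<Rightarrow> bool" where
  "is_limit L X f Xlim c \<longleftrightarrow> is_cone L X f Xlim c \<and>
     (\<forall>W e. is_cone L X f W e \<longrightarrow> (\<exists>!u. u \<in> hom_set L W Xlim \<and> (\<forall>n. c n \<cdot>\<^bsub>L\<^esub> u = e n)))"

definition cl_lim :: "('o, 'a, 'z) cat_scheme \<Rightarrow> 'a set \<Rightarrow> 'a set" where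
  "cl_lim L K = K \<union> {c n | X f Xlim c n. is_sequence L K X f \<and> is_limit L X f Xlim c}"

definition sigma_closed :: "('o, 'a, 'z) metric_cat_scheme \<Rightarrow> 'a set \<Rightarrow> 'a set \<Rightarrow> bool" where
  "sigma_closed L K L' \<longleftrightarrow>
     subcategory L L' \<and> K \<subseteq> L' \<and> local_closure L L' = L' \<and>
     (\<forall>X f Xlim c. is_sequence L K X f \<and> is_limit L X f Xlim c \<longrightarrow> (\<forall>n. c n \<in> L')) \<and>
     (\<forall>X f Xlim c Y h. is_sequence L K X f \<and> is_limit L X f Xlim c \<and>
        h \<in> hom_set L Y Xlim \<and> (\<forall>n. c n \<cdot>\<^bsub>L\<^esub> h \<in> L') \<longrightarrow> h \<in> L')"

definition sigma_closure :: "('o, 'a, 'z) metric_cat_scheme \<Rightarrow> 'a set \<Rightarrow> 'a set" where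
  "sigma_closure L K = \<Inter>{L'. sigma_closed L K L'}"

text \<open>The intersection is itself \<^const>\<open>sigma_closed\<close>, so it is the smallest such subcategory.\<close>

lemma (in mu_category) sigma_closed_sigma_closure:
  assumes "subcategory L K"
  shows "sigma_closed L K (sigma_closure L K)"
proof -
  have lc_sub: "local_closure L F \<subseteq> Arr L" for F
  proof -
    have "hom_topology L X Y closure_of (F \<inter> hom_set L X Y) \<subseteq> Arr L" for X Y
      by (metis (no_types, lifting) closure_of_subset_topspace hom_set_def mem_Collect_eq
          subset_eq topspace_hom_topology)
    then show ?thesis unfolding local_closure_def by blast
  qed
  have lc_sup: "F \<subseteq> local_closure L F" if "F \<subseteq> Arr L" for F
  proof
    fix f assume f: "f \<in> F"
    then have o: "Dom L f \<in> Obj L" "Cod L f \<in> Obj L"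
      using that Dom_in_Obj Cod_in_Obj by auto
    have "f \<in> F \<inter> hom_set L (Dom L f) (Cod L f)"
      using f that by (auto simp: hom_set_def)
    then have "f \<in> hom_topology L (Dom L f) (Cod L f) closure_of
                     (F \<inter> hom_set L (Dom L f) (Cod L f))"
      by (metis closure_of_subset inf_le2 subsetD topspace_hom_topology)
    with o show "f \<in> local_closure L F" unfolding local_closure_def by blast
  qed
  have lc_mono: "local_closure L F \<subseteq> local_closure L G" if "F \<subseteq> G" for F G
  proof -
    have "hom_topology L X Y closure_of (F \<inter> hom_set L X Y)
            \<subseteq> hom_topology L X Y closure_of (G \<inter> hom_set L X Y)" for X Y
      using that by (intro closure_of_mono) auto
    then show ?thesis unfolding local_closure_def by blast
  qed
  have subK: "K \<subseteq> Arr L" using assms by (simp add: subcategory_def)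
  have top: "sigma_closed L K (Arr L)"
    unfolding sigma_closed_def
  proof (intro conjI)
    show "subcategory L (Arr L)"
      unfolding subcategory_def
    proof (intro conjI ballI impI)
      fix f assume f: "f \<in> Arr L"
      show "Ide L (Dom L f) \<in> Arr L" "Ide L (Cod L f) \<in> Arr L"
        using f Ide_in_hom[OF Dom_in_Obj] Ide_in_hom[OF Cod_in_Obj] by (auto simp: hom_set_def)
      fix g assume "g \<in> Arr L" "Dom L g = Cod L f"
      then show "g \<cdot> f \<in> Arr L"
        using f Comp_in_hom[of f "Dom L f" "Cod L f" g "Cod L g"] by (auto simp: hom_set_def)
    qed simp
    show "K \<subseteq> Arr L" by (rule subK)
    show "local_closure L (Arr L) = Arr L" using lc_sub lc_sup by blast
  qed (auto simp: is_limit_def is_cone_def hom_set_def)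
  let ?S = "sigma_closure L K"
  have lower: "?S \<subseteq> L'" if "sigma_closed L K L'" for L'
    using that unfolding sigma_closure_def by blast
  have greatest: "x \<in> ?S" if "\<And>L'. sigma_closed L K L' \<Longrightarrow> x \<in> L'" for x
    using that unfolding sigma_closure_def by blast
  show ?thesis
    unfolding sigma_closed_def
  proof (intro conjI allI impI)
    show "subcategory L ?S"
      unfolding subcategory_def
    proof (intro conjI ballI impI)
      show "?S \<subseteq> Arr L" by (rule lower[OF top])
    next
      fix f assume f: "f \<in> ?S"
      have "Ide L (Dom L f) \<in> L' \<and> Ide L (Cod L f) \<in> L'" if L': "sigma_closed L K L'" for L'
        using lower[OF L'] f L' unfolding sigma_closed_def subcategory_def by blast
      then show "Ide L (Dom L f) \<in> ?S" "Ide L (Cod L f) \<in> ?S"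
        by (blast intro: greatest)+
    next
      fix f g assume fg: "f \<in> ?S" "g \<in> ?S" "Dom L g = Cod L f"
      show "g \<cdot> f \<in> ?S"
      proof (rule greatest)
        fix L' assume L': "sigma_closed L K L'"
        then have "f \<in> L'" "g \<in> L'" using fg lower by auto
        then show "g \<cdot> f \<in> L'"
          using L' fg(3) unfolding sigma_closed_def subcategory_def by blast
      qed
    qed
    show "K \<subseteq> ?S" unfolding sigma_closure_def sigma_closed_def by blast
    show "local_closure L ?S = ?S"
    proof
      show "?S \<subseteq> local_closure L ?S" by (rule lc_sup[OF lower[OF top]])
      show "local_closure L ?S \<subseteq> ?S"
      proof
        fix f assume f: "f \<in> local_closure L ?S"
        show "f \<in> ?S"
        proof (rule greatest)
          fix L' assume L': "sigma_closed L K L'"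
          then have "f \<in> local_closure L L'" using f lc_mono[OF lower] by blast
          then show "f \<in> L'" using L' by (simp add: sigma_closed_def)
        qed
      qed
    qed
  next
    fix X f Xlim c n assume "is_sequence L K X f \<and> is_limit L X f Xlim c"
    then show "c n \<in> ?S" unfolding sigma_closure_def sigma_closed_def by blast
  next
    fix X f Xlim c Y h
    assume a: "is_sequence L K X f \<and> is_limit L X f Xlim c \<and>
        h \<in> hom_set L Y Xlim \<and> (\<forall>n. c n \<cdot> h \<in> ?S)"
    show "h \<in> ?S"
    proof (rule greatest)
      fix L' assume L': "sigma_closed L K L'"
      then have "\<forall>n. c n \<cdot> h \<in> L'" using a lower by blast
      then show "h \<in> L'" using L' a unfolding sigma_closed_def by blast
    qed
  qed
qed


section \<open>The families $\mathcal{B}_0$ and $\mathcal{B}_1$, and $\sigma$-consistency\<close>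

definition B0 :: "('o, 'a, 'z) metric_cat_scheme \<Rightarrow> 'a set \<Rightarrow> 'a set" where
  "B0 L K = {h \<in> Arr L. Dom L h \<in> objs L (sigma_closure L K) \<and> Cod L h \<in> objs L K \<and>
     (\<forall>X f c. is_sequence L K X f \<and> is_limit L X f (Dom L h) c \<longrightarrow>
        (\<forall>\<epsilon>::real. \<epsilon> > 0 \<longrightarrow>
           (\<exists>n. \<exists>g \<in> K \<inter> hom_set L (X n) (Cod L h). approx L \<epsilon> h (g \<cdot>\<^bsub>L\<^esub> c n))))}"

definition B1 :: "('o, 'a, 'z) metric_cat_scheme \<Rightarrow> 'a set \<Rightarrow> 'a set" where
  "B1 L K = {h \<in> Arr L. Dom L h \<in> objs L (sigma_closure L K) \<and>
     Cod L h \<in> objs L (sigma_closure L K) \<and>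
     (\<forall>g \<in> B0 L K. Dom L g = Cod L h \<longrightarrow> g \<cdot>\<^bsub>L\<^esub> h \<in> B0 L K)}"

definition sigma_consistent :: "('o, 'a, 'z) metric_cat_scheme \<Rightarrow> 'a set \<Rightarrow> bool" where
  "sigma_consistent L K \<longleftrightarrow>
     (\<forall>X f Y g Z c e. is_sequence L K X f \<and> is_limit L X f Z c \<and>
        is_sequence L K Y g \<and> is_limit L Y g Z e \<longrightarrow>
        (\<forall>n. \<forall>\<epsilon>::real. \<epsilon> > 0 \<longrightarrow>
           (\<exists>m. \<exists>h \<in> K \<inter> hom_set L (X m) (Y n). approx L \<epsilon> (h \<cdot>\<^bsub>L\<^esub> c m) (e n))))"

end

theory Submission
  imports Defs
begin

text \<open>A cone map followed by a \<open>K\<close>-map is again a cone map (drop an initial segment of the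
  sequence and prepend the \<open>K\<close>-map), and a \<open>K\<close>-map is a cone map of an eventually constant
  sequence. Hence \<open>\<B>\<^sub>0\<close>-maps are approximated by elements of \<^const>\<open>cl_lim\<close>, and
  \<open>\<sigma>\<close>-consistency is precisely what is needed for the converse. In particular \<open>\<B>\<^sub>0\<close> is locally
  closed and lies in the \<open>\<sigma>\<close>-closure. With this, \<open>\<B>\<^sub>1\<close> satisfies the closure properties defining
  the \<open>\<sigma>\<close>-closure; conversely, for \<open>h \<in> \<B>\<^sub>1\<close> all composites of \<open>h\<close> with the cone maps into its
  codomain lie in \<open>\<B>\<^sub>0\<close>, hence in the \<open>\<sigma>\<close>-closure, and therefore so does \<open>h\<close>.\<close>

section \<open>Inverse limits of sequences: tails, prepended maps, constant sequences\<close>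

context category
begin

text \<open>A cone on the tail extends to the whole sequence by \<open>f 0 \<cdot> e 0\<close> at
  index 0. Conversely, a map compatible with the tail is compatible at index 0 too, because
  \<open>c 0 = f 0 \<cdot> c 1\<close>; this gives uniqueness.\<close>

lemma limit_drop_one:
  assumes f: "\<And>n. f n \<in> hom_set L (X (Suc n)) (X n)" and lim: "is_limit L X f Z c"
  shows "is_limit L (\<lambda>n. X (Suc n)) (\<lambda>n. f (Suc n)) Z (\<lambda>n. c (Suc n))"
  unfolding is_limit_def
proof (intro conjI allI impI)
  show "is_cone L (\<lambda>n. X (Suc n)) (\<lambda>n. f (Suc n)) Z (\<lambda>n. c (Suc n))"
    using lim by (auto simp: is_limit_def is_cone_def)
  fix W e assume e: "is_cone L (\<lambda>n. X (Suc n)) (\<lambda>n. f (Suc n)) W e"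
  have "f 0 \<cdot> e 0 \<in> hom_set L W (X 0)"
    using e f by (auto simp: is_cone_def intro: Comp_in_hom)
  then have "is_cone L X f W (case_nat (f 0 \<cdot> e 0) e)"
    using e by (auto simp: is_cone_def split: nat.splits)
  then obtain u where u: "u \<in> hom_set L W Z" "\<And>n. c n \<cdot> u = case_nat (f 0 \<cdot> e 0) e n"
    and uniq: "\<And>v. \<lbrakk>v \<in> hom_set L W Z; \<forall>n. c n \<cdot> v = case_nat (f 0 \<cdot> e 0) e n\<rbrakk> \<Longrightarrow> v = u"
    using lim unfolding is_limit_def by metis
  show "\<exists>!u. u \<in> hom_set L W Z \<and> (\<forall>n. c (Suc n) \<cdot> u = e n)"
  proof (rule ex1I[of _ u])
    show "u \<in> hom_set L W Z \<and> (\<forall>n. c (Suc n) \<cdot> u = e n)"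
      using u(1) u(2)[of "Suc n" for n] by simp
    fix v assume v: "v \<in> hom_set L W Z \<and> (\<forall>n. c (Suc n) \<cdot> v = e n)"
    have c: "c (Suc 0) \<in> hom_set L Z (X (Suc 0))" "f 0 \<cdot> c (Suc 0) = c 0"
      using lim by (auto simp: is_limit_def is_cone_def)
    have "c 0 \<cdot> v = f 0 \<cdot> e 0"
      using Comp_assoc[OF _ c(1) f, of v W] v c(2) by simp
    then show "v = u"
      using v by (intro uniq) (auto split: nat.splits)
  qed
qed

lemma limit_drop:
  assumes f: "\<And>n. f n \<in> hom_set L (X (Suc n)) (X n)" and lim: "is_limit L X f Z c"
  shows "is_limit L (\<lambda>n. X (k + n)) (\<lambda>n. f (k + n)) Z (\<lambda>n. c (k + n))"
proof (induction k)
  case 0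
  then show ?case using lim by simp
next
  case (Suc k)
  have "f (k + n) \<in> hom_set L (X (k + Suc n)) (X (k + n))" for n
    using f[of "k + n"] by simp
  from limit_drop_one[OF this Suc] show ?case by simp
qed

text \<open>In a cone over the lengthened sequence the component at 0 is forced to be
  \<open>g\<close> after the component at 1. So the mediating map for the shifted cone over the old
  sequence also serves the new one.\<close>

lemma limit_prepend:
  assumes f: "\<And>n. f n \<in> hom_set L (X (Suc n)) (X n)" and lim: "is_limit L X f Z c"
    and g: "g \<in> hom_set L (X 0) Y"
  shows "is_limit L (case_nat Y X) (case_nat g f) Z (case_nat (g \<cdot> c 0) c)"
  unfolding is_limit_def
proof (intro conjI allI impI)
  have c: "c 0 \<in> hom_set L Z (X 0)" "is_cone L X f Z c"
    using lim by (auto simp: is_limit_def is_cone_def)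
  then show "is_cone L (case_nat Y X) (case_nat g f) Z (case_nat (g \<cdot> c 0) c)"
    using Comp_in_hom[OF c(1) g] by (auto simp: is_cone_def split: nat.splits)
  fix W e assume e: "is_cone L (case_nat Y X) (case_nat g f) W e"
  have e_hom: "e n \<in> hom_set L W (case_nat Y X n)"
    and e_Comp: "case_nat g f n \<cdot> e (Suc n) = e n" for n
    using e by (auto simp: is_cone_def)
  have "is_cone L X f W (\<lambda>n. e (Suc n))"
    using e e_hom[of "Suc n" for n] e_Comp[of "Suc n" for n] by (auto simp: is_cone_def)
  then obtain u where u: "u \<in> hom_set L W Z" "\<And>n. c n \<cdot> u = e (Suc n)"
    and uniq: "\<And>v. \<lbrakk>v \<in> hom_set L W Z; \<forall>n. c n \<cdot> v = e (Suc n)\<rbrakk> \<Longrightarrow> v = u"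
    using lim unfolding is_limit_def by metis
  show "\<exists>!u. u \<in> hom_set L W Z \<and> (\<forall>n. case_nat (g \<cdot> c 0) c n \<cdot> u = e n)"
  proof (rule ex1I[of _ u])
    have "(g \<cdot> c 0) \<cdot> u = e 0"
      using Comp_assoc[OF u(1) c(1) g] u(2)[of 0] e_Comp[of 0] by simp
    then show "u \<in> hom_set L W Z \<and> (\<forall>n. case_nat (g \<cdot> c 0) c n \<cdot> u = e n)"
      using u by (auto split: nat.splits)
    fix v assume v: "v \<in> hom_set L W Z \<and> (\<forall>n. case_nat (g \<cdot> c 0) c n \<cdot> v = e n)"
    then have "c n \<cdot> v = e (Suc n)" for n
      by (metis old.nat.simps(5))
    with v show "v = u" by (intro uniq) auto
  qed
qed

text \<open>The cone equations make all components of a cone equal, so the mediating map is their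
  common value.\<close>

lemma limit_const:
  assumes "X \<in> Obj L"
  shows "is_limit L (\<lambda>_. X) (\<lambda>_. Ide L X) X (\<lambda>_. Ide L X)"
  unfolding is_limit_def
proof (intro conjI allI impI)
  show "is_cone L (\<lambda>_. X) (\<lambda>_. Ide L X) X (\<lambda>_. Ide L X)"
    using assms Ide_in_hom Ide_Comp by (auto simp: is_cone_def)
  fix W e assume "is_cone L (\<lambda>_. X) (\<lambda>_. Ide L X) W e"
  then have e: "e n \<in> hom_set L W X" "Ide L X \<cdot> e (Suc n) = e n" for n
    by (auto simp: is_cone_def)
  have "e n = e 0" for n
    by (induction n) (use e Ide_Comp in metis)+
  then show "\<exists>!u. u \<in> hom_set L W X \<and> (\<forall>n. Ide L X \<cdot> u = e n)"
    using e(1) Ide_Comp by metis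
qed

end

section \<open>Metric estimates and the local closure\<close>

context mu_category
begin

lemma approx_sym:
  "\<lbrakk>approx L \<epsilon> f g; f \<in> hom_set L X Y; g \<in> hom_set L X Y\<rbrakk> \<Longrightarrow> approx L \<epsilon> g f"
  using mdist_commute[of f X Y g] by (simp add: approx_def)

lemma approx_trans_half:
  assumes "approx L (\<epsilon>/2) f g" "approx L (\<epsilon>/2) g h" "\<epsilon> > 0"
    and "f \<in> hom_set L X Y" "g \<in> hom_set L X Y" "h \<in> hom_set L X Y"
  shows "approx L \<epsilon> f h"
proof -
  have "mdist L f h \<le> mdist L f g + mdist L g h"
    using assms mdist_triangle by blast
  also have "\<dots> < ennreal (\<epsilon>/2) + ennreal (\<epsilon>/2)"
    using assms by (intro add_strict_mono) (auto simp: approx_def)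
  also have "\<dots> = ennreal \<epsilon>"
    using assms by (simp flip: ennreal_plus)
  finally show ?thesis by (simp add: approx_def)
qed

lemma approx_refl: "\<lbrakk>f \<in> hom_set L X Y; \<epsilon> > 0\<rbrakk> \<Longrightarrow> approx L \<epsilon> f f"
  using mdist_eq_0[of f X Y f] by (simp add: approx_def)

lemma approx_Comp:
  "\<lbrakk>approx L \<epsilon> g h; f \<in> hom_set L X Y; g \<in> hom_set L Y Z; h \<in> hom_set L Y Z\<rbrakk>
    \<Longrightarrow> approx L \<epsilon> (g \<cdot> f) (h \<cdot> f)"
  unfolding approx_def by (rule le_less_trans[OF mdist_Comp_le])

text \<open>Usual triangle argument: around \<open>f\<close> the radius
  \<open>\<epsilon> - r\<close> works, where \<open>r\<close> is the distance from \<open>h\<close>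
  to \<open>f\<close>. It is a real number since it lies below
  \<open>ennreal \<epsilon>\<close>.\<close>

lemma hom_open_ball:
  assumes h: "h \<in> hom_set L X Y"
  shows "hom_open L X Y {g \<in> hom_set L X Y. approx L \<epsilon> h g}"
  unfolding hom_open_def
proof (intro conjI ballI)
  fix f assume "f \<in> {g \<in> hom_set L X Y. approx L \<epsilon> h g}"
  then have f: "f \<in> hom_set L X Y" and hf: "mdist L h f < ennreal \<epsilon>"
    by (auto simp: approx_def)
  then obtain r where r: "r \<ge> 0" "mdist L h f = ennreal r" "r < \<epsilon>"
    by (cases "mdist L h f") (auto simp: ennreal_less_iff)
  have "approx L \<epsilon> h g" if g: "g \<in> hom_set L X Y" "approx L (\<epsilon> - r) f g" for g
  proof -
    have "mdist L h g \<le> ennreal r + mdist L f g"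
      using mdist_triangle[OF h f g(1)] r by simp
    also have "\<dots> < ennreal r + ennreal (\<epsilon> - r)"
      using g(2) by (simp add: approx_def)
    also have "\<dots> = ennreal \<epsilon>"
      using r by (simp flip: ennreal_plus)
    finally show ?thesis by (simp add: approx_def)
  qed
  then show "\<exists>\<delta>::real. \<delta> > 0 \<and>
      (\<forall>g\<in>hom_set L X Y. approx L \<delta> f g \<longrightarrow> g \<in> {g \<in> hom_set L X Y. approx L \<epsilon> h g})"
    using r by (intro exI[of _ "\<epsilon> - r"]) auto
qed auto

text \<open>Trades the topological closure for approximation within a hom-set: one direction tests
  the closure condition on open balls, the other uses the ball inside a given open set.\<close>

lemma in_local_closure_iff:
  assumes h: "h \<in> hom_set L X Y"
  shows "h \<in> local_closure L F \<longleftrightarrow>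
    (\<forall>\<epsilon>::real. \<epsilon> > 0 \<longrightarrow> (\<exists>k \<in> F \<inter> hom_set L X Y. approx L \<epsilon> h k))"
proof -
  have XY: "X \<in> Obj L" "Y \<in> Obj L"
    using h Dom_in_Obj Cod_in_Obj by (auto simp: hom_set_def)
  have "h \<in> local_closure L F \<longleftrightarrow> h \<in> local_closure L F \<inter> hom_set L X Y"
    using h by simp
  also have "\<dots> \<longleftrightarrow>
      (\<forall>U. h \<in> U \<and> hom_open L X Y U \<longrightarrow> (\<exists>k \<in> F \<inter> hom_set L X Y. k \<in> U))"
    using h unfolding local_closure_Int_hom_set[OF XY] in_closure_of
      topspace_hom_topology openin_hom_topology by (simp add: Bex_def conj_assoc)
  also have "\<dots> \<longleftrightarrow> (\<forall>\<epsilon>::real. \<epsilon> > 0 \<longrightarrow> (\<exists>k \<in> F \<inter> hom_set L X Y. approx L \<epsilon> h k))"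
  proof (intro iffI allI impI)
    fix \<epsilon> :: real
    assume *: "\<forall>U. h \<in> U \<and> hom_open L X Y U \<longrightarrow> (\<exists>k \<in> F \<inter> hom_set L X Y. k \<in> U)"
      and "\<epsilon> > 0"
    then have "h \<in> {g \<in> hom_set L X Y. approx L \<epsilon> h g}"
      using h approx_refl by simp
    then have "\<exists>k \<in> F \<inter> hom_set L X Y. k \<in> {g \<in> hom_set L X Y. approx L \<epsilon> h g}"
      using hom_open_ball[OF h] by (intro *[rule_format] conjI)
    then show "\<exists>k \<in> F \<inter> hom_set L X Y. approx L \<epsilon> h k"
      by simp
  next
    fix U
    assume *: "\<forall>\<epsilon>::real. \<epsilon> > 0 \<longrightarrow> (\<exists>k \<in> F \<inter> hom_set L X Y. approx L \<epsilon> h k)"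
      and U: "h \<in> U \<and> hom_open L X Y U"
    obtain \<epsilon> :: real where "\<epsilon> > 0" "\<forall>g\<in>hom_set L X Y. approx L \<epsilon> h g \<longrightarrow> g \<in> U"
      using U unfolding hom_open_def by blast
    with * show "\<exists>k \<in> F \<inter> hom_set L X Y. k \<in> U" by blast
  qed
  finally show ?thesis .
qed

lemma local_closure_subset_Arr: "local_closure L F \<subseteq> Arr L"
proof -
  have "hom_topology L X Y closure_of G \<subseteq> hom_set L X Y" for X Y G
    by (metis closure_of_subset_topspace topspace_hom_topology)
  then show ?thesis
    unfolding local_closure_def hom_set_def by blast
qed

lemma local_closure_mono: "F \<subseteq> G \<Longrightarrow> local_closure L F \<subseteq> local_closure L G"
  unfolding local_closure_def by (intro UN_mono closure_of_mono) auto

lemma subset_local_closure: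
  assumes "F \<subseteq> Arr L"
  shows "F \<subseteq> local_closure L F"
proof
  fix f assume f: "f \<in> F"
  then have "f \<in> hom_set L (Dom L f) (Cod L f)"
    using assms by (auto simp: hom_set_def)
  with f show "f \<in> local_closure L F"
    using approx_refl in_local_closure_iff by blast
qed

text \<open>Once \<open>B0\<close> is identified with a local closure, this makes \<open>B0\<close>
  itself locally closed.\<close>

lemma local_closure_idem: "local_closure L (local_closure L F) = local_closure L F"
proof
  show "local_closure L (local_closure L F) \<subseteq> local_closure L F"
  proof
    fix h assume h: "h \<in> local_closure L (local_closure L F)"
    define X Y where "X = Dom L h" and "Y = Cod L h"
    have hom: "h \<in> hom_set L X Y"
      using h local_closure_subset_Arr by (auto simp: hom_set_def X_def Y_def)
    show "h \<in> local_closure L F"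
      unfolding in_local_closure_iff[OF hom]
    proof (intro allI impI)
      fix \<epsilon> :: real assume \<epsilon>: "\<epsilon> > 0"
      then obtain k where k: "k \<in> local_closure L F" "k \<in> hom_set L X Y" "approx L (\<epsilon>/2) h k"
        using h[unfolded in_local_closure_iff[OF hom]] half_gt_zero by blast
      then obtain l where "l \<in> F \<inter> hom_set L X Y" "approx L (\<epsilon>/2) k l"
        using \<epsilon> half_gt_zero unfolding in_local_closure_iff[OF k(2)] by blast
      with k \<epsilon> hom show "\<exists>k \<in> F \<inter> hom_set L X Y. approx L \<epsilon> h k"
        using approx_trans_half by blast
    qed
  qed
qed (rule subset_local_closure[OF local_closure_subset_Arr])

end

section \<open>Limit cones of \<open>K\<close>-sequences and the family
  \<open>cl_lim\<close>\<close>

locale mu_subcategory = mu_category L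
  for L :: "('o, 'a, 'z) metric_cat_scheme" (structure) +
  fixes K :: "'a set"
  assumes sub: "subcategory L K"
begin

definition limit_cone :: "(nat \<Rightarrow> 'o) \<Rightarrow> (nat \<Rightarrow> 'a) \<Rightarrow> 'o \<Rightarrow> (nat \<Rightarrow> 'a) \<Rightarrow> bool" where
  "limit_cone X f Z c \<longleftrightarrow> is_sequence L K X f \<and> is_limit L X f Z c"

lemma in_K_hom: "f \<in> K \<Longrightarrow> f \<in> hom_set L (Dom L f) (Cod L f)"
  using sub by (auto simp: subcategory_def hom_set_def)

lemma K_objs: "f \<in> K \<Longrightarrow> Dom L f \<in> objs L K" "f \<in> K \<Longrightarrow> Cod L f \<in> objs L K"
  using sub Dom_in_Obj Cod_in_Obj by (auto simp: subcategory_def objs_def)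

lemma K_Comp: "\<lbrakk>f \<in> K; g \<in> K; f \<in> hom_set L X Y; g \<in> hom_set L Y Z\<rbrakk> \<Longrightarrow> g \<cdot> f \<in> K"
  using sub by (auto simp: subcategory_def hom_set_def)

lemma limit_cone_hom: "limit_cone X f Z c \<Longrightarrow> c n \<in> hom_set L Z (X n)"
  by (auto simp: limit_cone_def is_limit_def is_cone_def)

lemma limit_cone_objs: "limit_cone X f Z c \<Longrightarrow> X n \<in> objs L K"
  using K_objs(2)[of "f n"] by (auto simp: limit_cone_def is_sequence_def hom_set_def)

lemma limit_cone_const: "X \<in> objs L K \<Longrightarrow> limit_cone (\<lambda>_. X) (\<lambda>_. Ide L X) X (\<lambda>_. Ide L X)"
  using limit_const Ide_in_hom by (auto simp: limit_cone_def is_sequence_def objs_def)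

text \<open>Exhibits \<open>g \<cdot> c k\<close> as a cone map, at index 0: discard the first
  \<open>k\<close> objects, then put \<open>Y\<close> in front via \<open>g\<close>. The limit
  object stays \<open>Z\<close>.\<close>

lemma limit_cone_drop_prepend:
  assumes lim: "limit_cone X f Z c" and g: "g \<in> K" "g \<in> hom_set L (X k) Y"
  shows "limit_cone (case_nat Y (\<lambda>n. X (k + n))) (case_nat g (\<lambda>n. f (k + n))) Z
    (case_nat (g \<cdot> c k) (\<lambda>n. c (k + n)))"
proof -
  have f: "f n \<in> hom_set L (X (Suc n)) (X n)" and fK: "f n \<in> K" for n
    using lim by (auto simp: limit_cone_def is_sequence_def)
  have "is_limit L X f Z c"
    using lim by (simp add: limit_cone_def)
  note lim' = limit_drop[OF f this, of k]
  have "f (k + n) \<in> hom_set L (X (k + Suc n)) (X (k + n))" for n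
    using f[of "k + n"] by simp
  from limit_prepend[OF this lim', of g Y] show ?thesis
    using g f fK by (auto simp: limit_cone_def is_sequence_def split: nat.splits)
qed

text \<open>A \<open>K\<close>-map \<open>g\<close> is the cone map at index 0 of the constant
  sequence on its domain with \<open>g\<close> prepended, since
  \<open>g \<cdot> Ide L (Dom L g) = g\<close>. Later arguments can thus treat every member of
  \<open>cl_lim\<close> as a cone map.\<close>

lemma cl_lim_altdef: "cl_lim L K = {c n | X f Z c n. limit_cone X f Z c}"
proof -
  have "\<exists>X f Z c n. g = c n \<and> limit_cone X f Z c" if g: "g \<in> K" for g
  proof -
    let ?X = "Dom L g"
    have "g = g \<cdot> Ide L ?X"
      using Comp_Ide in_K_hom[OF g] by metis
    with limit_cone_drop_prepend[OF limit_cone_const[OF K_objs(1)[OF g]] g in_K_hom[OF g]]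
    show ?thesis
      by (metis old.nat.simps(4))
  qed
  then show ?thesis
    unfolding cl_lim_def limit_cone_def by blast
qed

lemma limit_cone_in_cl_lim: "limit_cone X f Z c \<Longrightarrow> c n \<in> cl_lim L K"
  unfolding cl_lim_altdef by blast

lemma K_subset_cl_lim: "K \<subseteq> cl_lim L K"
  by (simp add: cl_lim_def)

lemma cl_lim_subset_Arr: "cl_lim L K \<subseteq> Arr L"
  using limit_cone_hom by (auto simp: cl_lim_altdef hom_set_def)

lemma cl_lim_Comp:
  assumes "limit_cone X f Z c" "g \<in> K" "g \<in> hom_set L (X n) Y"
  shows "g \<cdot> c n \<in> cl_lim L K"
  using limit_cone_in_cl_lim[OF limit_cone_drop_prepend[OF assms], of 0] by simp

section \<open>The sigma-closure and its objects\<close>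

lemma sigma_closedD:
  assumes "sigma_closed L K L'"
  shows "subcategory L L'" "K \<subseteq> L'" "local_closure L L' = L'"
    and "limit_cone X f Z c \<Longrightarrow> c n \<in> L'"
    and "\<lbrakk>limit_cone X f Z c; h \<in> hom_set L Y Z; \<And>n. c n \<cdot> h \<in> L'\<rbrakk> \<Longrightarrow> h \<in> L'"
  using assms unfolding sigma_closed_def limit_cone_def by blast+

lemma sigma_closedI:
  assumes "subcategory L L'" "K \<subseteq> L'" "local_closure L L' \<subseteq> L'"
    and "\<And>X f Z c n. limit_cone X f Z c \<Longrightarrow> c n \<in> L'"
    and "\<And>X f Z c Y h. \<lbrakk>limit_cone X f Z c; h \<in> hom_set L Y Z; \<And>n. c n \<cdot> h \<in> L'\<rbrakk> \<Longrightarrow> h \<in> L'"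
  shows "sigma_closed L K L'"
proof -
  have "local_closure L L' = L'"
    using assms(1,3) subset_local_closure by (auto simp: subcategory_def)
  then show ?thesis
    using assms unfolding sigma_closed_def limit_cone_def by auto
qed

lemmas sigma_closureD = sigma_closedD[OF sigma_closed_sigma_closure[OF sub]]

lemma sigma_closure_least: "sigma_closed L K L' \<Longrightarrow> sigma_closure L K \<subseteq> L'"
  unfolding sigma_closure_def by blast

abbreviation sigma_objs :: "'o set" where
  "sigma_objs \<equiv> objs L (sigma_closure L K)"

text \<open>The full subcategory on the limits of \<open>K\<close>-sequences satisfies all the closure properties.\<close>

lemma sigma_objs_eq: "sigma_objs = {Z. \<exists>X f c. limit_cone X f Z c}" (is "_ = ?S")
proof
  let ?F = "{h \<in> Arr L. Dom L h \<in> ?S \<and> Cod L h \<in> ?S}"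
  have K_S: "X \<in> ?S" if "X \<in> objs L K" for X
    using limit_cone_const[OF that] by blast
  have S_Obj: "?S \<subseteq> Obj L"
    by (auto simp: limit_cone_def is_limit_def is_cone_def)
  have "sigma_closed L K ?F"
  proof (rule sigma_closedI)
    show "subcategory L ?F"
      unfolding subcategory_def
    proof (intro conjI ballI impI)
      fix f g assume "f \<in> ?F" "g \<in> ?F" "Dom L g = Cod L f"
      then show "g \<cdot> f \<in> ?F"
        using Comp_in_hom[of f "Dom L f" "Cod L f" g "Cod L g"] by (auto simp: hom_set_def)
    next
      have "Ide L X \<in> ?F" if "X \<in> ?S" for X
      proof -
        have "Ide L X \<in> hom_set L X X"
          using Ide_in_hom that S_Obj by blast
        with that show ?thesis by (simp add: hom_set_def)
      qed
      then show "Ide L (Dom L f) \<in> ?F" "Ide L (Cod L f) \<in> ?F" if "f \<in> ?F" for f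
        using that by blast+
    qed auto
    show "K \<subseteq> ?F"
      using in_K_hom K_objs K_S by (auto simp: hom_set_def)
    show "local_closure L ?F \<subseteq> ?F"
    proof
      fix h assume h: "h \<in> local_closure L ?F"
      then have hom: "h \<in> hom_set L (Dom L h) (Cod L h)"
        using local_closure_subset_Arr by (auto simp: hom_set_def)
      \<comment> \<open>Membership in \<open>?F\<close> depends only on domain and codomain, so a
        single approximant from the same hom-set, here at distance below 1, suffices.\<close>
      then obtain k where "k \<in> ?F" "k \<in> hom_set L (Dom L h) (Cod L h)"
        using h[unfolded in_local_closure_iff[OF hom]] zero_less_one by blast
      with hom show "h \<in> ?F" by (auto simp: hom_set_def)
    qed
    fix X f Z c assume lim: "limit_cone X f Z c"
    show "c n \<in> ?F" for n
      using lim limit_cone_hom[OF lim, of n] K_S[OF limit_cone_objs[OF lim, of n]]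
      by (auto simp: hom_set_def)
    fix Y h assume "h \<in> hom_set L Y Z" "\<And>n. c n \<cdot> h \<in> ?F"
    \<comment> \<open>\<open>c 0 \<cdot> h\<close> has domain \<open>Y\<close>, so its membership in
      \<open>?F\<close> shows that \<open>Y\<close> is a limit object.\<close>
    moreover from this have "c 0 \<cdot> h \<in> hom_set L Y (X 0)"
      using limit_cone_hom[OF lim] Comp_in_hom by blast
    ultimately show "h \<in> ?F"
      using lim by (auto simp: hom_set_def)
  qed
  then show "sigma_objs \<subseteq> ?S"
    using sigma_closure_least Ide_in_hom by (fastforce simp: objs_def hom_set_def)
  show "?S \<subseteq> sigma_objs"
  proof
    fix Z assume "Z \<in> ?S"
    then obtain X f c where lim: "limit_cone X f Z c" by blast
    \<comment> \<open>A cone map lies in the sigma-closure and has domain \<open>Z\<close>; closure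
      under identities of domains then supplies \<open>Ide L Z\<close>.\<close>
    then have "c 0 \<in> sigma_closure L K" "Dom L (c 0) = Z"
      using sigma_closureD(4) limit_cone_hom[OF lim, of 0] by (auto simp: hom_set_def)
    with \<open>Z \<in> ?S\<close> S_Obj show "Z \<in> sigma_objs"
      using sigma_closureD(1) by (auto simp: objs_def subcategory_def)
  qed
qed

lemma limit_cone_sigma_objs: "limit_cone X f Z c \<Longrightarrow> Z \<in> sigma_objs"
  by (auto simp: sigma_objs_eq)

lemma K_objs_sigma_objs: "X \<in> objs L K \<Longrightarrow> X \<in> sigma_objs"
  using limit_cone_const limit_cone_sigma_objs by blast

section \<open>\<open>B0\<close> as the local closure of \<open>cl_lim\<close>\<close>

lemma B0D:
  assumes "h \<in> B0 L K" "h \<in> hom_set L Z Y" "limit_cone X f Z c" "\<epsilon> > 0"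
  obtains n g where "g \<in> K" "g \<in> hom_set L (X n) Y" "approx L \<epsilon> h (g \<cdot> c n)"
proof -
  have "Dom L h = Z" "Cod L h = Y"
    using assms(2) by (auto simp: hom_set_def)
  then show ?thesis
    using assms(1,3,4) that unfolding B0_def limit_cone_def by blast
qed

lemma B0_in_hom: "h \<in> B0 L K \<Longrightarrow> h \<in> hom_set L (Dom L h) (Cod L h)"
  by (simp add: B0_def hom_set_def)

text \<open>The domain of \<open>h\<close> is a sigma-object, hence the limit of some
  \<open>K\<close>-sequence. Applying the \<open>B0\<close> condition to this one cone yields
  approximants \<open>g \<cdot> c n\<close>, which are cone maps themselves.\<close>

lemma B0_subset_local_closure: "B0 L K \<subseteq> local_closure L (cl_lim L K)"
proof
  fix h assume h: "h \<in> B0 L K"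
  then obtain X f c where lim: "limit_cone X f (Dom L h) c"
    unfolding B0_def using sigma_objs_eq by blast
  show "h \<in> local_closure L (cl_lim L K)"
    unfolding in_local_closure_iff[OF B0_in_hom[OF h]]
  proof (intro allI impI)
    fix \<epsilon> :: real assume "\<epsilon> > 0"
    then obtain n g where g: "g \<in> K" "g \<in> hom_set L (X n) (Cod L h)" "approx L \<epsilon> h (g \<cdot> c n)"
      using B0D[OF h B0_in_hom[OF h] lim] by blast
    then show "\<exists>k \<in> cl_lim L K \<inter> hom_set L (Dom L h) (Cod L h). approx L \<epsilon> h k"
      using cl_lim_Comp[OF lim g(1,2)] Comp_in_hom[OF limit_cone_hom[OF lim]] by blast
  qed
qed

lemma local_closure_cl_lim_subset_sigma_closure:
  "local_closure L (cl_lim L K) \<subseteq> sigma_closure L K"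
proof -
  have "cl_lim L K \<subseteq> sigma_closure L K"
    using sigma_closureD(4) by (auto simp: cl_lim_altdef)
  then show ?thesis
    using local_closure_mono sigma_closureD(3) by blast
qed

text \<open>Given any limit cone \<open>c\<close> on the domain of \<open>h\<close>, first
  approximate \<open>h\<close> by a cone map \<open>e n\<close> of a possibly different sequence
  with the same limit object. Sigma-consistency then replaces \<open>e n\<close> by some
  \<open>g \<cdot> c m\<close>, at a cost of \<open>\<epsilon>/2\<close> each time.\<close>

lemma local_closure_subset_B0:
  assumes "sigma_consistent L K"
  shows "local_closure L (cl_lim L K) \<subseteq> B0 L K"
proof
  fix h assume h: "h \<in> local_closure L (cl_lim L K)"
  define Z Y where "Z = Dom L h" and "Y = Cod L h"
  have hom: "h \<in> hom_set L Z Y"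
    using h local_closure_subset_Arr by (auto simp: hom_set_def Z_def Y_def)
  have ap: "\<exists>k \<in> cl_lim L K \<inter> hom_set L Z Y. approx L \<epsilon> h k" if "\<epsilon> > 0" for \<epsilon> :: real
    using h that unfolding in_local_closure_iff[OF hom] by blast
  have cone: "\<exists>X f c n. limit_cone X f Z c \<and> X n = Y \<and> k = c n"
    if "k \<in> cl_lim L K \<inter> hom_set L Z Y" for k
    using that limit_cone_hom unfolding cl_lim_altdef hom_set_def by fastforce
  \<comment> \<open>The bound 1 is arbitrary: one approximating cone map shows that \<open>Z\<close>
    is a sigma-object and \<open>Y\<close> a \<open>K\<close>-object.\<close>
  from ap[OF zero_less_one] obtain X f c n where "limit_cone X f Z c" "X n = Y"
    using cone by blast
  then have ZY: "Z \<in> sigma_objs" "Y \<in> objs L K"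
    using limit_cone_sigma_objs limit_cone_objs by blast+
  have "\<exists>n. \<exists>g \<in> K \<inter> hom_set L (X n) Y. approx L \<epsilon> h (g \<cdot> c n)"
    if lim: "limit_cone X f Z c" and \<epsilon>: "\<epsilon> > 0" for X f c and \<epsilon> :: real
  proof -
    obtain X' f' e n where e: "limit_cone X' f' Z e" "X' n = Y" "approx L (\<epsilon>/2) h (e n)"
      using ap[of "\<epsilon>/2"] cone \<epsilon> half_gt_zero by metis
    obtain m g where g: "g \<in> K" "g \<in> hom_set L (X m) Y" "approx L (\<epsilon>/2) (g \<cdot> c m) (e n)"
      using assms lim e(1,2) half_gt_zero[OF \<epsilon>]
      unfolding sigma_consistent_def limit_cone_def by blast
    have homs: "g \<cdot> c m \<in> hom_set L Z Y" "e n \<in> hom_set L Z Y"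
      using Comp_in_hom[OF limit_cone_hom[OF lim] g(2)] limit_cone_hom[OF e(1), of n] e(2) by auto
    have "approx L \<epsilon> h (g \<cdot> c m)"
      using approx_trans_half[OF e(3) approx_sym[OF g(3) homs] \<epsilon> hom homs(2,1)] .
    with g show ?thesis by blast
  qed
  with hom ZY show "h \<in> B0 L K"
    unfolding B0_def limit_cone_def hom_set_def by auto
qed

section \<open>\<open>B1\<close> and the sigma-closure\<close>

lemma B1_subset_sigma_closure:
  assumes "sigma_consistent L K"
  shows "B1 L K \<subseteq> sigma_closure L K"
proof
  fix h assume h: "h \<in> B1 L K"
  then have "h \<in> hom_set L (Dom L h) (Cod L h)"
    by (simp add: B1_def hom_set_def)
  moreover obtain X f c where lim: "limit_cone X f (Cod L h) c"
    using h unfolding B1_def using sigma_objs_eq by blast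
  moreover have "c n \<cdot> h \<in> sigma_closure L K" for n
  proof -
    \<comment> \<open>Consistency places the cone maps in \<open>B0\<close>, which makes them
      admissible test maps in the definition of \<open>B1\<close>.\<close>
    have "c n \<in> B0 L K"
      using limit_cone_in_cl_lim[OF lim] local_closure_subset_B0[OF assms]
        subset_local_closure[OF cl_lim_subset_Arr] by blast
    with h have "c n \<cdot> h \<in> B0 L K"
      using limit_cone_hom[OF lim, of n] by (auto simp: B1_def hom_set_def)
    then show ?thesis
      using B0_subset_local_closure local_closure_cl_lim_subset_sigma_closure by blast
  qed
  ultimately show "h \<in> sigma_closure L K"
    using sigma_closureD(5) by blast
qed

text \<open>Every nontrivial closure property asks that \<open>g \<cdot> h\<close> lie in
  \<open>B0\<close> for a test map \<open>g\<close> in \<open>B0\<close>. Since \<open>B0\<close> is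
  locally closed, it is enough to approximate \<open>g \<cdot> h\<close> by members of
  \<open>B0\<close>, by perturbing either \<open>g\<close> or \<open>h\<close>.\<close>

lemma sigma_closed_B1:
  assumes cons: "sigma_consistent L K"
  shows "sigma_closed L K (B1 L K)"
proof -
  have B0_eq: "B0 L K = local_closure L (cl_lim L K)"
    using B0_subset_local_closure local_closure_subset_B0[OF cons] by blast
  have cl_lim_B0: "cl_lim L K \<subseteq> B0 L K"
    unfolding B0_eq by (rule subset_local_closure[OF cl_lim_subset_Arr])
  have B0_closed: "h \<in> B0 L K"
    if "h \<in> hom_set L X Y"
      "\<And>\<epsilon>::real. \<epsilon> > 0 \<Longrightarrow> \<exists>k. k \<in> B0 L K \<and> k \<in> hom_set L X Y \<and> approx L \<epsilon> h k" for h X Y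
  proof -
    have "h \<in> local_closure L (B0 L K)"
      using that(2) unfolding in_local_closure_iff[OF that(1)] by blast
    then show ?thesis by (simp add: B0_eq local_closure_idem)
  qed
  have B1I: "h \<in> B1 L K"
    if "h \<in> hom_set L X Y" "X \<in> sigma_objs" "Y \<in> sigma_objs"
      "\<And>g Z. \<lbrakk>g \<in> B0 L K; g \<in> hom_set L Y Z\<rbrakk> \<Longrightarrow> g \<cdot> h \<in> B0 L K" for h X Y
    using that B0_in_hom by (auto simp: B1_def hom_set_def)
  have B1_hom: "h \<in> hom_set L (Dom L h) (Cod L h)"
    and B1_objs: "Dom L h \<in> sigma_objs" "Cod L h \<in> sigma_objs" if "h \<in> B1 L K" for h
    using that by (auto simp: B1_def hom_set_def)
  have B1_B0: "g \<cdot> h \<in> B0 L K"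
    if "h \<in> B1 L K" "g \<in> B0 L K" "h \<in> hom_set L X Y" "g \<in> hom_set L Y Z" for g h X Y Z
    using that by (auto simp: B1_def hom_set_def)
  have limit_B1: "c n \<in> B1 L K" if lim: "limit_cone X f Z c" for X f Z c n
  proof (rule B1I)
    show c: "c n \<in> hom_set L Z (X n)"
      by (rule limit_cone_hom[OF lim])
    have Xn: "X n \<in> objs L K"
      by (rule limit_cone_objs[OF lim])
    then show "X n \<in> sigma_objs"
      by (rule K_objs_sigma_objs)
    show "Z \<in> sigma_objs"
      by (rule limit_cone_sigma_objs[OF lim])
    fix g Y assume g: "g \<in> B0 L K" "g \<in> hom_set L (X n) Y"
    show "g \<cdot> c n \<in> B0 L K"
    proof (rule B0_closed)
      show "g \<cdot> c n \<in> hom_set L Z Y"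
        using Comp_in_hom[OF c g(2)] .
      fix \<epsilon> :: real assume "\<epsilon> > 0"
      \<comment> \<open>The \<open>B0\<close> condition is applied to the constant sequence at
        \<open>X n\<close>, whose cone maps are identities: a \<open>B0\<close>-map out of a
        \<open>K\<close>-object is thus approximated by \<open>K\<close>-maps \<open>g'\<close>, and
        \<open>g' \<cdot> c n\<close> lies in \<open>cl_lim\<close>.\<close>
      then obtain g' where g': "g' \<in> K" "g' \<in> hom_set L (X n) Y"
        "approx L \<epsilon> g (g' \<cdot> Ide L (X n))"
        using B0D[OF g limit_cone_const[OF Xn]] by blast
      then have "approx L \<epsilon> (g \<cdot> c n) (g' \<cdot> c n)"
        using approx_Comp[OF _ c g(2) g'(2)] Comp_Ide by metis
      then show "\<exists>k. k \<in> B0 L K \<and> k \<in> hom_set L Z Y \<and> approx L \<epsilon> (g \<cdot> c n) k"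
        using cl_lim_Comp[OF lim g'(1,2)] cl_lim_B0 Comp_in_hom[OF c g'(2)] by blast
    qed
  qed
  show ?thesis
  proof (rule sigma_closedI)
    show "subcategory L (B1 L K)"
      unfolding subcategory_def
    proof (intro conjI ballI impI)
      show "B1 L K \<subseteq> Arr L" by (auto simp: B1_def)
    next
      have "Ide L X \<in> B1 L K" if "X \<in> sigma_objs" for X
        using that Ide_in_hom[of X] Comp_Ide by (intro B1I[of _ X X]) (auto simp: objs_def)
      then show "Ide L (Dom L f) \<in> B1 L K" "Ide L (Cod L f) \<in> B1 L K" if "f \<in> B1 L K" for f
        using that B1_objs by blast+
    next
      fix f g assume f: "f \<in> B1 L K" and g: "g \<in> B1 L K" and fg: "Dom L g = Cod L f"
      note f_hom = B1_hom[OF f] and g_hom = B1_hom[OF g, unfolded fg]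
      show "g \<cdot> f \<in> B1 L K"
      proof (rule B1I[OF Comp_in_hom[OF f_hom g_hom] B1_objs(1)[OF f] B1_objs(2)[OF g]])
        fix k Z assume k: "k \<in> B0 L K" "k \<in> hom_set L (Cod L g) Z"
        have "(k \<cdot> g) \<cdot> f \<in> B0 L K"
          using B1_B0[OF f B1_B0[OF g k(1) g_hom k(2)] f_hom] Comp_in_hom[OF g_hom k(2)] by blast
        then show "k \<cdot> (g \<cdot> f) \<in> B0 L K"
          by (simp add: Comp_assoc[OF f_hom g_hom k(2)])
      qed
    qed
    show "K \<subseteq> B1 L K"
      using limit_B1 K_subset_cl_lim by (auto simp: cl_lim_altdef)
    show "local_closure L (B1 L K) \<subseteq> B1 L K"
    proof
      fix h assume h: "h \<in> local_closure L (B1 L K)"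
      define X Y where "X = Dom L h" and "Y = Cod L h"
      have hom: "h \<in> hom_set L X Y"
        using h local_closure_subset_Arr by (auto simp: hom_set_def X_def Y_def)
      have ap: "\<exists>k \<in> B1 L K \<inter> hom_set L X Y. approx L \<epsilon> h k" if "\<epsilon> > 0" for \<epsilon> :: real
        using h that unfolding in_local_closure_iff[OF hom] by blast
      from ap[OF zero_less_one] have XY: "X \<in> sigma_objs" "Y \<in> sigma_objs"
        using B1_objs by (auto simp: hom_set_def)
      show "h \<in> B1 L K"
      proof (rule B1I[OF hom XY])
        fix g Z assume g: "g \<in> B0 L K" "g \<in> hom_set L Y Z"
        show "g \<cdot> h \<in> B0 L K"
        proof (rule B0_closed)
          show "g \<cdot> h \<in> hom_set L X Z"
            by (rule Comp_in_hom[OF hom g(2)])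
          fix \<epsilon> :: real assume "\<epsilon> > 0"
          \<comment> \<open>Here \<open>g\<close> is fixed and \<open>h\<close> is perturbed, so the
            estimate comes from uniform continuity of post-composition with \<open>g\<close>, not
            from the contraction property.\<close>
          from Comp_uniform[OF g(2) this] obtain \<delta> :: real where \<delta>: "\<delta> > 0"
            "\<And>k. \<lbrakk>k \<in> hom_set L X Y; approx L \<delta> h k\<rbrakk> \<Longrightarrow> approx L \<epsilon> (g \<cdot> h) (g \<cdot> k)"
            using hom XY(1) unfolding approx_def objs_def by blast
          obtain k where k: "k \<in> B1 L K" "k \<in> hom_set L X Y" "approx L \<delta> h k"
            using ap[OF \<delta>(1)] by blast
          show "\<exists>k. k \<in> B0 L K \<and> k \<in> hom_set L X Z \<and> approx L \<epsilon> (g \<cdot> h) k"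
            using \<delta>(2)[OF k(2,3)] B1_B0[OF k(1) g(1) k(2) g(2)] Comp_in_hom[OF k(2) g(2)] by blast
        qed
      qed
    qed
    fix X f Z c assume lim: "limit_cone X f Z c"
    show "c n \<in> B1 L K" for n
      by (rule limit_B1[OF lim])
    fix Y h assume h: "h \<in> hom_set L Y Z" "\<And>n. c n \<cdot> h \<in> B1 L K"
    note ch_hom = Comp_in_hom[OF h(1) limit_cone_hom[OF lim]]
    have "Y \<in> sigma_objs"
      using B1_objs(1)[OF h(2)[of 0]] ch_hom[of 0] by (simp add: hom_set_def)
    then show "h \<in> B1 L K"
    proof (rule B1I[OF h(1) _ limit_cone_sigma_objs[OF lim]])
      fix g V assume g: "g \<in> B0 L K" "g \<in> hom_set L Z V"
      show "g \<cdot> h \<in> B0 L K"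
      proof (rule B0_closed)
        show "g \<cdot> h \<in> hom_set L Y V"
          by (rule Comp_in_hom[OF h(1) g(2)])
        fix \<epsilon> :: real assume "\<epsilon> > 0"
        \<comment> \<open>Now \<open>g\<close> is perturbed instead: it is close to
          \<open>g' \<cdot> c n\<close> with \<open>g'\<close> in \<open>K\<close>, and precomposing
          with \<open>h\<close> does not increase distances. Reassociated, the approximant is
          \<open>g'\<close>, a member of \<open>B0\<close>, after the \<open>B1\<close>-map
          \<open>c n \<cdot> h\<close>, hence in \<open>B0\<close>.\<close>
        then obtain n g' where g': "g' \<in> K" "g' \<in> hom_set L (X n) V"
          "approx L \<epsilon> g (g' \<cdot> c n)"
          using B0D[OF g lim] by blast
        note c = limit_cone_hom[OF lim, of n]
        have "approx L \<epsilon> (g \<cdot> h) (g' \<cdot> (c n \<cdot> h))"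
          using approx_Comp[OF g'(3) h(1) g(2) Comp_in_hom[OF c g'(2)]]
          by (simp add: Comp_assoc[OF h(1) c g'(2)])
        moreover have "g' \<cdot> (c n \<cdot> h) \<in> B0 L K"
          using B1_B0[OF h(2) _ ch_hom g'(2)] g'(1) K_subset_cl_lim cl_lim_B0 by blast
        ultimately show "\<exists>k. k \<in> B0 L K \<and> k \<in> hom_set L Y V \<and> approx L \<epsilon> (g \<cdot> h) k"
          using Comp_in_hom[OF ch_hom g'(2)] by blast
      qed
    qed
  qed
qed

end

theorem corollaryA16:
  fixes L :: "('o, 'a) metric_cat" and K :: "'a set"
  assumes "mu_category L"
    and "subcategory L K"
    and "sigma_consistent L K"
  shows "B0 L K = local_closure L (cl_lim L K) \<and> B1 L K = sigma_closure L K"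
proof -
  interpret mu_subcategory L K
    using assms(1,2) by (simp add: mu_subcategory_def mu_subcategory_axioms_def)
  show ?thesis
    using B0_subset_local_closure local_closure_subset_B0[OF assms(3)]
      B1_subset_sigma_closure[OF assms(3)] sigma_closure_least[OF sigma_closed_B1[OF assms(3)]]
    by blast
qed

end
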